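(* Let $N\ge1$. The dual cone $\mathcal{C}^*$ of the cone $\mathcal{C}=\{u\in\mathbb{R}^{2N-1}:T(u)\succeq0\}$ is equal to the set of finite autocorrelation sequences, i.e. to the set of all $z\in\mathbb{R}^{2N-1}$ for which there exists $q\in\mathbb{C}^N$ with $$(z_{\mathbb{C}})_k=\sum_{n=0}^{N-1-k}\bar q_n\,q_{n+k},\qquad k=0,\dots,N-1.$$
   Context: Vectors are indexed from $0$ and $j=\sqrt{-1}$. For $u=(u_0,\dots,u_{2N-2})^{\mathrm T}\in\mathbb{R}^{2N-1}$, $T(u)\in\mathbb{C}^{N\times N}$ is the Hermitian Toeplitz matrix whose first row is $(2u_0,\,u_1+ju_N,\,u_2+ju_{N+1},\dots,\,u_{N-1}+ju_{2N-2})$. The notation $\succeq0$ means positive semidefinite. The dual cone is $\mathcal{C}^*=\{z\in\mathbb{R}^{2N-1}:z^{\mathrm T}u\ge0\ \forall u\in\mathcal{C}\}$. For $z\in\mathbb{R}^{2N-1}$, $z_{\mathbb{C}}\in\mathbb{C}^N$ denotes the vector $z_{\mathbb{C}}=(z_0,\,z_1+jz_N,\,z_2+jz_{N+1},\dots,\,z_{N-1}+jz_{2N-2})^{\mathrm T}$. *)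

theory Defs
  imports "Jordan_Normal_Form.Schur_Decomposition"
begin

definition hermitian_mat :: "complex mat \<Rightarrow> bool" where
  "hermitian_mat A \<longleftrightarrow> mat_adjoint A = A"

text \<open>With the library's convention for \<open>\<bullet>c\<close> (conjugate the second argument), the
  scalar below is the quadratic form $v^* A v$.\<close>

definition psd_mat :: "complex mat \<Rightarrow> bool" where
  "psd_mat A \<longleftrightarrow> square_mat A \<and> hermitian_mat A \<and>
     (\<forall>v \<in> carrier_vec (dim_row A). Re ((A *\<^sub>v v) \<bullet>c v) \<ge> 0)"

definition hermitian_toeplitz :: "complex vec \<Rightarrow> complex mat" where
  "hermitian_toeplitz r = mat (dim_vec r) (dim_vec r)
     (\<lambda>(m, n). if m \<le> n then r $ (n - m) else cnj (r $ (m - n)))"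

definition toeplitz_first_row :: "nat \<Rightarrow> real vec \<Rightarrow> complex vec" where
  "toeplitz_first_row N u =
     vec N (\<lambda>k. if k = 0 then complex_of_real (2 * (u $ 0)) else Complex (u $ k) (u $ (N + k - 1)))"

definition T :: "nat \<Rightarrow> real vec \<Rightarrow> complex mat" where
  "T N u = hermitian_toeplitz (toeplitz_first_row N u)"

lemma T_first_row:
  "k < N \<Longrightarrow> T N u $$ (0, k) =
     (if k = 0 then complex_of_real (2 * (u $ 0)) else Complex (u $ k) (u $ (N + k - 1)))"
  by (simp add: T_def hermitian_toeplitz_def toeplitz_first_row_def)

lemma T_toeplitz:
  "Suc m < N \<Longrightarrow> Suc n < N \<Longrightarrow> T N u $$ (Suc m, Suc n) = T N u $$ (m, n)"
  by (simp add: T_def hermitian_toeplitz_def toeplitz_first_row_def)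

lemma hermitian_T: "hermitian_mat (T N u)"
  unfolding hermitian_mat_def
  by (rule eq_matI)
     (auto simp: mat_adjoint_def mat_of_rows_def T_def hermitian_toeplitz_def
        toeplitz_first_row_def complex_eq_iff)

definition toeplitz_cone :: "nat \<Rightarrow> real vec set" where
  "toeplitz_cone N = {u \<in> carrier_vec (2 * N - 1). psd_mat (T N u)}"

definition dual_cone :: "nat \<Rightarrow> real vec set \<Rightarrow> real vec set" where
  "dual_cone d C = {z \<in> carrier_vec d. \<forall>u \<in> C. z \<bullet> u \<ge> 0}"

definition complexify :: "nat \<Rightarrow> real vec \<Rightarrow> complex vec" where
  "complexify N z =
     vec N (\<lambda>k. if k = 0 then complex_of_real (z $ 0) else Complex (z $ k) (z $ (N + k - 1)))"

definition finite_autocorrelations :: "nat \<Rightarrow> real vec set" where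
  "finite_autocorrelations N =
     {z \<in> carrier_vec (2 * N - 1). \<exists>q \<in> carrier_vec N. \<forall>k \<in> {0..N - 1}.
        complexify N z $ k = (\<Sum>n = 0..N - 1 - k. cnj (q $ n) * q $ (n + k))}"

end

theory Submission
  imports Defs "HOL-Computational_Algebra.Fundamental_Theorem_Algebra"
begin

text \<open>If \<open>z\<close> is the autocorrelation of \<open>q\<close>, then \<open>2 (z \<bullet> u) = v\<^sup>* T(u) v\<close> with \<open>v\<close> the conjugate
  of \<open>q\<close>, so \<open>z\<close> lies in the dual cone. Conversely, pairing \<open>z\<close> in the dual cone with those \<open>u\<close>
  for which \<open>T(u)\<close> is the rank-one matrix of an exponential on the unit circle shows that the
  trigonometric polynomial with coefficients \<open>z\<^sub>\<complex>\<close> is nonnegative; by the Fejer--Riesz theorem it is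
  the squared modulus of a polynomial \<open>q\<close>, whose autocorrelation is \<open>z\<close>.
  Fejer--Riesz is proved by induction on the degree: a root \<open>\<alpha>\<close> of the associated self-reciprocal
  polynomial always comes with the factor \<open>(x - \<alpha>) (1 - cnj \<alpha> x)\<close>, whose modulus on the circle is
  \<open>\<bar>x - \<alpha>\<bar>\<^sup>2\<close>; the degenerate case \<open>\<alpha> = 0\<close> just lowers the degree bound at both ends.\<close>

section \<open>Polynomials on the unit circle and their reflections\<close>

lemma infinite_unit_circle: "infinite {z::complex. cmod z = 1}"
proof
  assume "finite {z::complex. cmod z = 1}"
  then have "finite (Re ` {z::complex. cmod z = 1})" by blast
  moreover have "{0..1} \<subseteq> Re ` {z::complex. cmod z = 1}"
  proof
    fix x :: real assume "x \<in> {0..1}"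
    then have "x\<^sup>2 \<le> 1" by (simp add: power_le_one)
    then have "cmod (Complex x (sqrt (1 - x\<^sup>2))) = 1" by (simp add: cmod_def)
    then show "x \<in> Re ` {z::complex. cmod z = 1}"
      by (intro image_eqI[of _ _ "Complex x (sqrt (1 - x\<^sup>2))"]) auto
  qed
  ultimately have "finite {0..1::real}" by (rule finite_subset[rotated])
  then show False by (simp add: infinite_Icc)
qed

text \<open>A nonzero difference has only finitely many roots. This turns identities that use
  \<open>cnj z * z = 1\<close> into identities of polynomials.\<close>

lemma poly_eq_if_eq_on_circle:
  fixes p q :: "complex poly"
  assumes "\<And>z. cmod z = 1 \<Longrightarrow> poly p z = poly q z"
  shows "p = q"
proof (rule ccontr)
  assume "p \<noteq> q"
  then have "finite {z. poly (p - q) z = 0}" by (intro poly_roots_finite) simp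
  moreover have "{z. cmod z = 1} \<subseteq> {z. poly (p - q) z = 0}" using assms by auto
  ultimately show False using infinite_unit_circle finite_subset by blast
qed

lemma cnj_mult_self_eq_1: "cmod z = 1 \<Longrightarrow> cnj z * z = 1"
  by (metis complex_norm_square mult.commute of_real_1 one_power2)

text \<open>On the unit circle, \<open>conj_reflect m p\<close> is \<open>x\<^sup>m\<close> times the conjugate of \<open>p\<close>.\<close>

definition conj_reflect :: "nat \<Rightarrow> complex poly \<Rightarrow> complex poly" where
  "conj_reflect m p = (\<Sum>i\<le>m. monom (cnj (coeff p (m - i))) i)"

lemma coeff_conj_reflect:
  "coeff (conj_reflect m p) i = (if i \<le> m then cnj (coeff p (m - i)) else 0)"
  by (simp add: conj_reflect_def coeff_sum)

lemma poly_eq_sum_le: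
  fixes p :: "'a::comm_semiring_1 poly"
  assumes "degree p \<le> m"
  shows "poly p x = (\<Sum>i\<le>m. coeff p i * x ^ i)"
proof -
  have "(\<Sum>i\<le>degree p. coeff p i * x ^ i) = (\<Sum>i\<le>m. coeff p i * x ^ i)"
    by (rule sum.mono_neutral_left) (use assms in \<open>auto simp: coeff_eq_0\<close>)
  then show ?thesis by (simp only: poly_altdef)
qed

text \<open>The hypothesis allows any \<open>w\<close> with mirror image \<open>z\<close> in the
  circle: \<open>w = z\<close> on the circle itself, and off it the pair of a root \<alpha> and
  \<open>1 / cnj \<alpha>\<close>.\<close>

lemma poly_conj_reflect:
  assumes "degree p \<le> m" "cnj w * z = 1"
  shows "poly (conj_reflect m p) z = z ^ m * cnj (poly p w)"
proof -
  have "poly (conj_reflect m p) z = (\<Sum>i\<le>m. cnj (coeff p (m - i)) * z ^ i)"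
    by (simp add: conj_reflect_def poly_sum poly_monom)
  also have "\<dots> = (\<Sum>i\<le>m. cnj (coeff p i) * z ^ (m - i))"
    by (rule sum.reindex_bij_witness[of _ "\<lambda>i. m - i" "\<lambda>i. m - i"]) auto
  also have "\<dots> = (\<Sum>i\<le>m. z ^ m * (cnj (coeff p i) * cnj w ^ i))"
  proof (rule sum.cong)
    fix i assume "i \<in> {..m}"
    then have "z ^ m = z ^ (m - i) * z ^ i" by (simp flip: power_add)
    moreover have "z ^ i * cnj w ^ i = 1"
      using assms(2) by (metis mult.commute power_mult_distrib power_one)
    ultimately show "cnj (coeff p i) * z ^ (m - i) = z ^ m * (cnj (coeff p i) * cnj w ^ i)"
      by (simp add: algebra_simps)
  qed simp
  also have "\<dots> = z ^ m * cnj (poly p w)"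
    by (simp add: poly_eq_sum_le[OF assms(1)] sum_distrib_left mult_ac)
  finally show ?thesis .
qed

section \<open>The Fejer-Riesz theorem\<close>

text \<open>On the circle \<open>cnj z ^ m\<close> is \<open>z\<close> to the power
  \<open>-m\<close>, so this concerns the Laurent polynomial obtained by shifting \<open>p\<close>
  down by \<open>m\<close>.\<close>

definition nonneg_on_circle :: "nat \<Rightarrow> complex poly \<Rightarrow> bool" where
  "nonneg_on_circle m p \<longleftrightarrow>
     (\<forall>z. cmod z = 1 \<longrightarrow> Im (cnj z ^ m * poly p z) = 0 \<and> 0 \<le> Re (cnj z ^ m * poly p z))"

text \<open>Being real on the circle means equality with the conjugate; multiplied by
  \<open>z ^ m\<close>, this says that \<open>p\<close> and its reflection agree there.\<close>

lemma conj_reflect_nonneg_on_circle: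
  assumes "nonneg_on_circle m p" "degree p \<le> 2 * m"
  shows "conj_reflect (2 * m) p = p"
proof (rule poly_eq_if_eq_on_circle)
  fix z assume z: "cmod z = 1"
  note zz = cnj_mult_self_eq_1[OF z]
  let ?r = "cnj z ^ m * poly p z"
  have "Im ?r = 0" using assms(1) z unfolding nonneg_on_circle_def by blast
  then have "cnj ?r = ?r" by (metis complex_cnj complex.collapse minus_zero)
  moreover have "cnj ?r = z ^ m * cnj (poly p z)" by simp
  moreover have pow: "z ^ m * cnj z ^ m = 1"
    using zz by (metis mult.commute power_mult_distrib power_one)
  have "z ^ (2 * m) = z ^ m * z ^ m" by (simp add: power_add mult_2)
  then have "poly (conj_reflect (2 * m) p) z = z ^ m * (z ^ m * cnj (poly p z))"
    unfolding poly_conj_reflect[OF assms(2) zz] by (simp only: mult.assoc)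
  ultimately have "poly (conj_reflect (2 * m) p) z = z ^ m * cnj z ^ m * poly p z"
    by (simp only: mult.assoc)
  then show "poly (conj_reflect (2 * m) p) z = poly p z" unfolding pow by simp
qed

text \<open>Along the arc \<open>\<alpha> e\<^sup>i\<^sup>t\<close> the factor \<open>z - \<alpha>\<close> equals \<open>2 sin (t/2)\<close> times a
  unimodular continuous factor; since \<open>sin (t/2)\<close> changes sign at \<open>t = 0\<close>, the cofactor must vanish there.\<close>

lemma unimodular_root_multiple:
  assumes nn: "nonneg_on_circle m ([:-\<alpha>, 1:] * p)" and \<alpha>: "cmod \<alpha> = 1"
  shows "poly p \<alpha> = 0"
proof -
  define H where "H t = \<i> * cis (t / 2) * \<alpha> * cnj (\<alpha> * cis t) ^ m * poly p (\<alpha> * cis t)" for t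
  have cis1: "cis t - 1 = 2 * of_real (sin (t / 2)) * (\<i> * cis (t / 2))" for t
    using cos_double_sin[of "t / 2"] sin_double[of "t / 2"]
    by (simp add: complex_eq_iff power2_eq_square)
  have H: "of_real (2 * sin (t / 2)) * H t
      = cnj (\<alpha> * cis t) ^ m * poly ([:-\<alpha>, 1:] * p) (\<alpha> * cis t)" for t
  proof -
    have "\<alpha> * cis t - \<alpha> = \<alpha> * (cis t - 1)" by (simp add: algebra_simps)
    then show ?thesis unfolding H_def cis1 by (simp add: algebra_simps)
  qed
  have nn: "sin (t / 2) * Im (H t) = 0 \<and> 0 \<le> sin (t / 2) * Re (H t)" for t
  proof -
    have "cmod (\<alpha> * cis t) = 1" using \<alpha> by (simp add: norm_mult)
    then have "Im (of_real (2 * sin (t / 2)) * H t) = 0 \<and> 0 \<le> Re (of_real (2 * sin (t / 2)) * H t)"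
      unfolding H using assms(1) unfolding nonneg_on_circle_def by blast
    then show ?thesis by (simp add: mult.commute)
  qed
  have cont: "(H \<longlongrightarrow> H 0) (at 0 within S)" for S
  proof -
    have "continuous_on UNIV H" unfolding H_def by (intro continuous_intros) auto
    then have "isCont H 0" by (simp add: continuous_on_eq_continuous_at)
    then show ?thesis unfolding continuous_at by (rule filterlim_mono) (auto intro: at_le)
  qed
  have R: "\<forall>\<^sub>F t in at_right (0::real). 0 < t \<and> t < pi"
    by (rule eventually_at_rightI[of 0 pi]) auto
  have L: "\<forall>\<^sub>F t in at_left (0::real). -pi < t \<and> t < 0"
    by (rule eventually_at_leftI[of "-pi" 0]) auto
  have sinR: "0 < sin (t / 2)" if "0 < t" "t < pi" for t
    using that by (intro sin_gt_zero) auto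
  have sinL: "sin (t / 2) < 0" if "-pi < t" "t < 0" for t
    using sinR[of "-t"] that by simp
  have "0 \<le> Re (H 0)"
  proof (rule tendsto_lowerbound[OF tendsto_Re[OF cont]])
    show "\<forall>\<^sub>F t in at_right 0. 0 \<le> Re (H t)"
      using R by eventually_elim (use nn sinR in \<open>force simp: zero_le_mult_iff\<close>)
  qed simp
  moreover have "Re (H 0) \<le> 0"
  proof (rule tendsto_upperbound[OF tendsto_Re[OF cont]])
    show "\<forall>\<^sub>F t in at_left 0. Re (H t) \<le> 0"
      using L by eventually_elim (use nn sinL in \<open>force simp: zero_le_mult_iff\<close>)
  qed simp
  moreover have "Im (H 0) = 0"
  proof (rule tendsto_unique[OF _ tendsto_Im[OF cont]])
    show "((\<lambda>t. Im (H t)) \<longlongrightarrow> 0) (at_right 0)"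
      by (rule tendsto_eventually) (use R in eventually_elim, use nn sinR in force)
  qed simp
  ultimately have "H 0 = 0" by (simp add: complex_eq_iff)
  then show ?thesis using \<alpha> by (auto simp: H_def)
qed

text \<open>For \<open>z\<close> on the circle other than \<alpha>, the removed factor contributes
  the positive number \<open>(cmod (z - \<alpha>))\<^sup>2\<close>. If \<alpha> itself lies on the
  circle, the sign there follows by continuity along an arc ending at \<alpha>.\<close>

lemma nonneg_on_circle_div_factor:
  assumes nn: "nonneg_on_circle (Suc m) ([:-\<alpha>, 1:] * [:1, - cnj \<alpha>:] * h)"
  shows "nonneg_on_circle m h"
proof -
  define F where "F z = cnj z ^ m * poly h z" for z
  have off: "Im (F z) = 0 \<and> 0 \<le> Re (F z)" if z: "cmod z = 1" "z \<noteq> \<alpha>" for z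
  proof -
    note zz = cnj_mult_self_eq_1[OF z(1)]
    have "1 - cnj \<alpha> * z = z * cnj (z - \<alpha>)" using zz by (simp add: algebra_simps)
    moreover have "poly ([:-\<alpha>, 1:] * [:1, - cnj \<alpha>:] * h) z = (z - \<alpha>) * (1 - cnj \<alpha> * z) * poly h z"
      unfolding poly_mult by (simp add: mult.commute)
    ultimately have "poly ([:-\<alpha>, 1:] * [:1, - cnj \<alpha>:] * h) z = (z - \<alpha>) * (z * cnj (z - \<alpha>)) * poly h z"
      by (simp only:)
    then have "cnj z ^ Suc m * poly ([:-\<alpha>, 1:] * [:1, - cnj \<alpha>:] * h) z
        = (cnj z * z) * ((z - \<alpha>) * cnj (z - \<alpha>)) * F z"
      unfolding F_def by simp
    also have "\<dots> = of_real ((cmod (z - \<alpha>))\<^sup>2) * F z"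
      unfolding zz by (simp only: complex_norm_square mult_1)
    finally have "Im (of_real ((cmod (z - \<alpha>))\<^sup>2) * F z) = 0
        \<and> 0 \<le> Re (of_real ((cmod (z - \<alpha>))\<^sup>2) * F z)"
      using nn z(1) unfolding nonneg_on_circle_def by metis
    then show ?thesis using z(2) by (simp add: zero_le_mult_iff)
  qed
  have at: "Im (F \<alpha>) = 0 \<and> 0 \<le> Re (F \<alpha>)" if \<alpha>: "cmod \<alpha> = 1"
  proof -
    define G where "G t = F (\<alpha> * cis t)" for t
    have "continuous_on UNIV G" unfolding G_def F_def by (intro continuous_intros)
    then have "isCont G 0" by (simp add: continuous_on_eq_continuous_at)
    then have cont: "(G \<longlongrightarrow> G 0) (at_right 0)"
      unfolding continuous_at by (rule filterlim_mono) (auto intro: at_le)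
    have ev: "\<forall>\<^sub>F t in at_right 0. Im (G t) = 0 \<and> 0 \<le> Re (G t)"
    proof (rule eventually_at_rightI[of 0 pi])
      fix t :: real assume t: "t \<in> {0<..<pi}"
      have "\<alpha> * cis t \<noteq> \<alpha>"
      proof
        assume "\<alpha> * cis t = \<alpha>"
        then have "cis t = 1" using \<alpha> by auto
        then have "sin t = 0" by (simp add: complex_eq_iff)
        then show False using t sin_gt_zero[of t] by simp
      qed
      then show "Im (G t) = 0 \<and> 0 \<le> Re (G t)"
        unfolding G_def using \<alpha> by (intro off) (auto simp: norm_mult)
    qed simp
    have "0 \<le> Re (G 0)"
      by (rule tendsto_lowerbound[OF tendsto_Re[OF cont]]) (use ev in \<open>auto elim: eventually_mono\<close>)
    moreover have "Im (G 0) = 0"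
    proof (rule tendsto_unique[OF _ tendsto_Im[OF cont]])
      show "((\<lambda>t. Im (G t)) \<longlongrightarrow> 0) (at_right 0)"
        by (rule tendsto_eventually) (use ev in \<open>auto elim: eventually_mono\<close>)
    qed simp
    ultimately show ?thesis by (simp add: G_def)
  qed
  show ?thesis unfolding nonneg_on_circle_def using off at unfolding F_def by metis
qed

text \<open>Equality with its own reflection gives \<open>p\<close> the root
  \<open>1 / cnj \<alpha>\<close> along with \<alpha>. If the two coincide, the sign condition makes
  the root a multiple one.\<close>

lemma nonneg_on_circle_factor:
  assumes nn: "nonneg_on_circle (Suc m) p" and deg: "degree p \<le> 2 * Suc m" and "p \<noteq> 0"
  obtains \<alpha> h where "p = [:-\<alpha>, 1:] * [:1, - cnj \<alpha>:] * h" "degree h \<le> 2 * m"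
proof -
  have refl: "conj_reflect (2 * Suc m) p = p"
    by (rule conj_reflect_nonneg_on_circle[OF nn deg])
  have top: "coeff p (2 * Suc m) = cnj (coeff p 0)"
    using coeff_conj_reflect[of "2 * Suc m" p "2 * Suc m"] unfolding refl by simp
  have "\<exists>\<alpha>. poly p \<alpha> = 0"
  \<comment> \<open>Without a root \<open>p\<close> is constant, so its coefficient at
    \<open>2 * Suc m\<close> vanishes; by \<open>top\<close> so does the constant term, hence
    \<open>p = 0\<close>.\<close>
  proof (rule ccontr)
    assume "\<nexists>\<alpha>. poly p \<alpha> = 0"
    then have "constant (poly p)" using fundamental_theorem_of_algebra by blast
    then have "degree p = 0" by (simp add: constant_degree)
    then show False
      using top \<open>p \<noteq> 0\<close> by (metis coeff_eq_0 complex_cnj_zero_iff leading_coeff_0_iff mult_is_0 nat.simps(3)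
          neq0_conv zero_neq_numeral)
  qed
  then obtain \<alpha> where \<alpha>: "poly p \<alpha> = 0" by blast
  then obtain p1 where p1: "p = [:-\<alpha>, 1:] * p1" by (metis dvdE poly_eq_0_iff_dvd)
  have "\<exists>h. p1 = [:1, - cnj \<alpha>:] * h \<and> degree h \<le> 2 * m"
  proof (cases "\<alpha> = 0")
    case True
    \<comment> \<open>The second factor is now 1. The degree bound still falls by two: once because
      the top coefficient vanishes with the constant term, once by division by
      \<open>x\<close>.\<close>
    then have "coeff p 0 = 0" using p1 by simp
    then have "coeff p (2 * Suc m) = 0" using top by simp
    then have "degree p \<noteq> 2 * Suc m" using \<open>p \<noteq> 0\<close> by (metis leading_coeff_0_iff)
    moreover have "degree p = Suc (degree p1)"
      using \<open>p \<noteq> 0\<close> unfolding p1 by (subst degree_mult_eq) auto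
    ultimately show ?thesis using True deg by (intro exI[of _ p1]) (auto simp: one_pCons[symmetric])
  next
    case False
    define \<beta> where "\<beta> = 1 / cnj \<alpha>"
    have \<beta>: "\<beta> * cnj \<alpha> = 1" using False by (simp add: \<beta>_def)
    have "poly p1 \<beta> = 0"
    proof (cases "\<beta> = \<alpha>")
      case True
      then have "of_real ((cmod \<alpha>)\<^sup>2) = (1::complex)"
        using \<beta> by (simp only: complex_norm_square)
      then have "(cmod \<alpha>)\<^sup>2 = 1" by (simp only: of_real_eq_1_iff)
      then have "cmod \<alpha> = 1" using power2_eq_1_iff[of "cmod \<alpha>"] norm_ge_zero[of \<alpha>] by linarith
      then show ?thesis using unimodular_root_multiple nn True unfolding p1 by blast
    next
      case neq: False
      have "poly p \<beta> = \<beta> ^ (2 * Suc m) * cnj (poly p \<alpha>)"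
        using poly_conj_reflect[OF deg, of \<alpha> \<beta>] \<beta> unfolding refl by (simp add: mult.commute)
      then have "(\<beta> - \<alpha>) * poly p1 \<beta> = 0" using \<alpha> unfolding p1 by (simp add: algebra_simps)
      then show ?thesis using neq by simp
    qed
    then obtain g where g: "p1 = [:-\<beta>, 1:] * g" by (metis dvdE poly_eq_0_iff_dvd)
    have "[:-\<beta>, 1:] = smult (-\<beta>) [:1, - cnj \<alpha>:]" using \<beta> by simp
    then have h: "p1 = [:1, - cnj \<alpha>:] * smult (-\<beta>) g" unfolding g by (simp add: algebra_simps)
    have "p1 \<noteq> 0" "g \<noteq> 0" using \<open>p \<noteq> 0\<close> p1 g by auto
    have "degree p = Suc (degree p1)" unfolding p1 by (subst degree_mult_eq) (use \<open>p1 \<noteq> 0\<close> in auto)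
    moreover have "degree p1 = Suc (degree g)"
      unfolding g by (subst degree_mult_eq) (use \<open>g \<noteq> 0\<close> in auto)
    ultimately have "degree p = Suc (Suc (degree g))" by simp
    then have "degree (smult (-\<beta>) g) \<le> 2 * m" using deg degree_smult_le[of "-\<beta>" g] by simp
    then show ?thesis using h by blast
  qed
  then show thesis using that p1 by (metis mult.assoc)
qed

lemma fejer_riesz_poly:
  assumes "nonneg_on_circle m p" "degree p \<le> 2 * m"
  shows "\<exists>q. degree q \<le> m \<and> p = q * conj_reflect m q"
  using assms
proof (induction m arbitrary: p)
  case 0
  then obtain c where c: "p = [:c:]" by (metis degree_eq_zeroE le_zero_eq mult_0_right)
  have "Im c = 0 \<and> 0 \<le> Re c"
    using "0.prems"(1)[unfolded nonneg_on_circle_def, rule_format, of 1] by (simp add: c)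
  then have "p = [:of_real (sqrt (Re c)):] * conj_reflect 0 [:of_real (sqrt (Re c)):]"
    unfolding c by (simp add: conj_reflect_def monom_0 complex_eq_iff)
  then show ?case by (intro exI[of _ "[:of_real (sqrt (Re c)):]"]) simp
next
  case (Suc m)
  show ?case
  proof (cases "p = 0")
    case True
    then show ?thesis by (intro exI[of _ 0]) simp
  next
    case False
    obtain \<alpha> h where p: "p = [:-\<alpha>, 1:] * [:1, - cnj \<alpha>:] * h" and h: "degree h \<le> 2 * m"
      using nonneg_on_circle_factor[OF Suc.prems False] .
    have "nonneg_on_circle m h"
      using Suc.prems(1) unfolding p by (rule nonneg_on_circle_div_factor)
    from Suc.IH[OF this h] obtain q where q: "degree q \<le> m" "h = q * conj_reflect m q" by blast
    let ?q = "[:-\<alpha>, 1:] * q"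
    have dq: "degree ?q \<le> Suc m" using degree_mult_le[of "[:-\<alpha>, 1:]" q] q(1) by simp
    \<comment> \<open>Reflection is multiplicative when the degree bounds add, and
      \<open>[:1, - cnj \<alpha>:]\<close> is the reflection of \<open>[:-\<alpha>, 1:]\<close> for
      the bound 1.\<close>
    have "conj_reflect (Suc m) ?q = [:1, - cnj \<alpha>:] * conj_reflect m q"
    proof (rule poly_eq_if_eq_on_circle)
      fix z assume "cmod z = 1"
      note zz = cnj_mult_self_eq_1[OF this]
      have "poly (conj_reflect (Suc m) ?q) z = z ^ m * cnj (poly q z) * (z * cnj (z - \<alpha>))"
        unfolding poly_conj_reflect[OF dq zz] poly_mult by simp
      also have "z * cnj (z - \<alpha>) = 1 - cnj \<alpha> * z" using zz by (simp add: algebra_simps)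
      finally show "poly (conj_reflect (Suc m) ?q) z = poly ([:1, - cnj \<alpha>:] * conj_reflect m q) z"
        unfolding poly_mult poly_conj_reflect[OF q(1) zz] by (simp add: mult_ac)
    qed
    then have "p = ?q * conj_reflect (Suc m) ?q" unfolding p q(2) by (simp only: mult_ac)
    then show ?thesis using dq by blast
  qed
qed

text \<open>On the circle the product is \<open>z ^ m\<close> times the squared modulus of
  \<open>q\<close>, so index \<open>m + k\<close> carries the autocorrelation at lag
  \<open>k\<close>.\<close>

lemma coeff_mult_conj_reflect:
  assumes "degree q \<le> m"
  shows "coeff (q * conj_reflect m q) (m + k) = (\<Sum>n<Suc m - k. cnj (coeff q n) * coeff q (n + k))"
proof -
  have "coeff (q * conj_reflect m q) (m + k)
      = (\<Sum>i\<le>m + k. coeff q i * coeff (conj_reflect m q) (m + k - i))"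
    by (simp add: coeff_mult)
  \<comment> \<open>For \<open>i < k\<close> the reflection is read beyond index \<open>m\<close>,
    and for \<open>i > m\<close> the coefficient of \<open>q\<close> is zero.\<close>
  also have "\<dots> = (\<Sum>i=k..<Suc m. coeff q i * coeff (conj_reflect m q) (m + k - i))"
    using assms by (intro sum.mono_neutral_right) (auto simp: coeff_conj_reflect coeff_eq_0)
  also have "\<dots> = (\<Sum>n<Suc m - k. cnj (coeff q n) * coeff q (n + k))"
    by (rule sum.reindex_bij_witness[of _ "\<lambda>n. n + k" "\<lambda>i. i - k"])
       (auto simp: coeff_conj_reflect)
  finally show ?thesis .
qed

section \<open>The quadratic form of a Hermitian Toeplitz matrix\<close>

text \<open>Entries are paired with their transposes along the diagonals. At \<open>k = 0\<close>
  each entry is its own partner and counts twice, whence the extra sum on the left.\<close>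

lemma sum_by_diagonals:
  fixes g :: "nat \<Rightarrow> nat \<Rightarrow> 'a::comm_monoid_add"
  shows "(\<Sum>m<N. \<Sum>n<N. g m n) + (\<Sum>m<N. g m m)
    = (\<Sum>k<N. \<Sum>n<N - k. g n (n + k) + g (n + k) n)"
proof (induction N)
  case 0
  show ?case by simp
next
  case (Suc N)
  let ?G = "\<lambda>m n. g m n + g n m"
  \<comment> \<open>A new last row and column lengthen each diagonal by one pair; the new diagonal
    \<open>k = N\<close> consists of that pair alone.\<close>
  have split: "(\<Sum>k<Suc N. \<Sum>n<Suc N - k. ?G n (n + k))
      = (\<Sum>k<Suc N. (\<Sum>n<N - k. ?G n (n + k)) + ?G (N - k) N)"
    by (rule sum.cong) (auto simp: Suc_diff_le less_Suc_eq_le)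
  have last: "\<dots> = (\<Sum>k<N. \<Sum>n<N - k. ?G n (n + k)) + (\<Sum>k<Suc N. ?G (N - k) N)"
    by (simp only: sum.distrib sum.lessThan_Suc) simp
  have flip: "(\<Sum>k<Suc N. ?G (N - k) N) = (\<Sum>k<Suc N. ?G k N)"
    by (rule sum.reindex_bij_witness[of _ "\<lambda>i. N - i" "\<lambda>i. N - i"]) auto
  show ?case
    unfolding split last flip Suc.IH[symmetric] by (simp add: sum.distrib ac_simps)
qed

text \<open>Entries from \<open>N\<close> on are the imaginary parts, and the real part of
  \<open>a * cnj b\<close> is the real inner product of \<open>a\<close> and \<open>b\<close> in the
  plane.\<close>

lemma scalar_prod_complexify:
  assumes "N \<ge> 1" "z \<in> carrier_vec (2 * N - 1)" "u \<in> carrier_vec (2 * N - 1)"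
  shows "z \<bullet> u = Re (\<Sum>k<N. complexify N z $ k * cnj (complexify N u $ k))"
proof -
  obtain M where N: "N = Suc M" using assms(1) by (cases N) auto
  have "z \<bullet> u = (\<Sum>i<Suc M + M. z $ i * u $ i)"
    using assms by (simp add: scalar_prod_def N atLeast0LessThan mult_2)
  also have "\<dots> = (\<Sum>i<Suc M. z $ i * u $ i) + (\<Sum>i<M. z $ (i + Suc M) * u $ (i + Suc M))"
    using sum.atLeastLessThan_concat[of 0 "Suc M" "Suc M + M" "\<lambda>i. z $ i * u $ i"]
      sum.shift_bounds_nat_ivl[of "\<lambda>i. z $ i * u $ i" 0 "Suc M" M]
    by (simp add: atLeast0LessThan add.commute)
  also have "\<dots> = Re (\<Sum>k<Suc M. complexify N z $ k * cnj (complexify N u $ k))"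
    unfolding sum.lessThan_Suc_shift
    by (simp add: complexify_def N sum.distrib add.commute add.left_commute)
  finally show ?thesis by (simp add: N)
qed

lemma T_index:
  assumes "m < N" "n < N"
  shows "T N u $$ (m, n) = (if m = n then of_real (2 * u $ 0)
    else if m < n then complexify N u $ (n - m) else cnj (complexify N u $ (m - n)))"
  using assms
  by (auto simp: T_def hermitian_toeplitz_def toeplitz_first_row_def complexify_def)

lemma dim_T: "dim_row (T N u) = N" "dim_col (T N u) = N"
  by (simp_all add: T_def hermitian_toeplitz_def toeplitz_first_row_def)

lemma T_quadratic_form_eq_sum:
  assumes "v \<in> carrier_vec N"
  shows "(T N u *\<^sub>v v) \<bullet>c v = (\<Sum>m<N. \<Sum>n<N. T N u $$ (m, n) * v $ n * cnj (v $ m))"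
  using assms
  by (simp add: scalar_prod_def dim_T atLeast0LessThan sum_distrib_right row_def)

text \<open>Transposed entries are conjugate, so each pair contributes twice a real part. The
  doubled \<open>u $ 0\<close> on the diagonal makes \<open>k = 0\<close> fit the same
  formula.\<close>

lemma Re_T_quadratic_form:
  assumes "v \<in> carrier_vec N"
  shows "Re ((T N u *\<^sub>v v) \<bullet>c v)
    = 2 * Re (\<Sum>k<N. complexify N u $ k * (\<Sum>n<N - k. v $ (n + k) * cnj (v $ n)))"
proof -
  let ?g = "\<lambda>m n. Re (T N u $$ (m, n) * v $ n * cnj (v $ m))"
  \<comment> \<open>The surplus at \<open>k = 0\<close> is the diagonal counted twice in
    \<open>sum_by_diagonals\<close>; it cancels at the end.\<close>
  have off: "(\<Sum>n<N - k. ?g n (n + k) + ?g (n + k) n)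
      = 2 * Re (complexify N u $ k * (\<Sum>n<N - k. v $ (n + k) * cnj (v $ n)))
        + (if k = 0 then (\<Sum>m<N. ?g m m) else 0)" if "k < N" for k
  proof (cases "k = 0")
    case True
    have "?g m m = 2 * Re (complexify N u $ k * (v $ m * cnj (v $ m)))" if "m < N" for m
    proof -
      have "T N u $$ (m, m) = 2 * complexify N u $ k"
        using that True by (simp add: T_index complexify_def)
      then show ?thesis by (simp add: algebra_simps)
    qed
    then have "(\<Sum>m<N. ?g m m) = (\<Sum>m<N. 2 * Re (complexify N u $ k * (v $ m * cnj (v $ m))))"
      by (intro sum.cong) auto
    then show ?thesis using True
      by (simp only: sum_distrib_left Re_sum if_True refl sum.distrib add_0_right diff_zero)
  next
    case False
    have "?g n (n + k) + ?g (n + k) n = 2 * Re (complexify N u $ k * (v $ (n + k) * cnj (v $ n)))"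
      if "n < N - k" for n
    proof -
      have "T N u $$ (n, n + k) = complexify N u $ k"
        "T N u $$ (n + k, n) = cnj (complexify N u $ k)"
        using that False by (simp_all add: T_index)
      then show ?thesis by (simp add: algebra_simps)
    qed
    then have "(\<Sum>n<N - k. ?g n (n + k) + ?g (n + k) n)
        = (\<Sum>n<N - k. 2 * Re (complexify N u $ k * (v $ (n + k) * cnj (v $ n))))"
      by (intro sum.cong) auto
    then show ?thesis using False by (simp only: sum_distrib_left Re_sum if_False add_0_right)
  qed
  have "(\<Sum>m<N. \<Sum>n<N. ?g m n) + (\<Sum>m<N. ?g m m)
      = (\<Sum>k<N. 2 * Re (complexify N u $ k * (\<Sum>n<N - k. v $ (n + k) * cnj (v $ n))))
        + (\<Sum>m<N. ?g m m)"
    (is "_ = ?A + ?D")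
  proof -
    have "(\<Sum>m<N. \<Sum>n<N. ?g m n) + ?D
        = (\<Sum>k<N. 2 * Re (complexify N u $ k * (\<Sum>n<N - k. v $ (n + k) * cnj (v $ n)))
            + (if k = 0 then ?D else 0))"
      unfolding sum_by_diagonals[of ?g] by (intro sum.cong refl off) simp
    also have "\<dots> = ?A + (\<Sum>k<N. if k = 0 then ?D else 0)" by (rule sum.distrib)
    also have "(\<Sum>k<N. if k = 0 then ?D else 0) = ?D"
      by (cases "N = 0") (simp_all only: sum.delta finite_lessThan lessThan_iff, simp_all)
    finally show ?thesis .
  qed
  then show ?thesis
    unfolding T_quadratic_form_eq_sum[OF assms] by (simp only: Re_sum sum_distrib_left add_right_cancel)
qed

section \<open>The two inclusions\<close>

lemma finite_autocorrelations_subset_dual_cone: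
  assumes "N \<ge> 1"
  shows "finite_autocorrelations N \<subseteq> dual_cone (2 * N - 1) (toeplitz_cone N)"
proof
  fix z assume "z \<in> finite_autocorrelations N"
  then obtain q where z: "z \<in> carrier_vec (2 * N - 1)" and q: "q \<in> carrier_vec N"
    and zq: "\<And>k. k \<in> {0..N - 1} \<Longrightarrow>
      complexify N z $ k = (\<Sum>n = 0..N - 1 - k. cnj (q $ n) * q $ (n + k))"
    unfolding finite_autocorrelations_def by blast
  have "0 \<le> z \<bullet> u" if "u \<in> toeplitz_cone N" for u
  proof -
    have u: "u \<in> carrier_vec (2 * N - 1)" "psd_mat (T N u)"
      using that by (auto simp: toeplitz_cone_def)
    \<comment> \<open>Conjugating \<open>q\<close> conjugates its autocorrelation, which gives the
      \<open>cnj\<close> that \<open>scalar_prod_complexify\<close> puts on the second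
      vector.\<close>
    let ?v = "conjugate q"
    have v: "?v \<in> carrier_vec N" using q by simp
    have "cnj (complexify N z $ k) = (\<Sum>n<N - k. ?v $ (n + k) * cnj (?v $ n))" if "k < N" for k
    proof -
      have "{0..N - 1 - k} = {..<N - k}" using that by auto
      then have "cnj (complexify N z $ k) = (\<Sum>n<N - k. cnj (cnj (q $ n) * q $ (n + k)))"
        using zq[of k] that by simp
      also have "\<dots> = (\<Sum>n<N - k. ?v $ (n + k) * cnj (?v $ n))"
        using q by (intro sum.cong) auto
      finally show ?thesis .
    qed
    then have "2 * Re (\<Sum>k<N. complexify N u $ k * cnj (complexify N z $ k)) = Re ((T N u *\<^sub>v ?v) \<bullet>c ?v)"
      unfolding Re_T_quadratic_form[OF v] by simp
    also have "\<dots> \<ge> 0" using u(2) v unfolding psd_mat_def dim_T by blast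
    finally have "0 \<le> u \<bullet> z" using scalar_prod_complexify[OF assms u(1) z] by simp
    then show ?thesis using comm_scalar_prod[OF z u(1)] by simp
  qed
  then show "z \<in> dual_cone (2 * N - 1) (toeplitz_cone N)" using z by (simp add: dual_cone_def)
qed

text \<open>The matrix has entries \<open>w ^ m * cnj w ^ n\<close>, so its quadratic form is a
  squared modulus. The value \<open>1 / 2\<close> compensates for the doubling of
  \<open>u $ 0\<close> in \<open>T\<close>.\<close>

lemma exponential_in_toeplitz_cone:
  assumes "N \<ge> 1" "cmod w = 1"
  obtains u where "u \<in> toeplitz_cone N"
    "\<And>k. k < N \<Longrightarrow> complexify N u $ k = (if k = 0 then 1 / 2 else cnj w ^ k)"
proof -
  define u where "u = vec (2 * N - 1)
    (\<lambda>i. if i = 0 then 1 / 2 else if i < N then Re (cnj w ^ i) else Im (cnj w ^ (i - N + 1)))"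
  have cu: "complexify N u $ k = (if k = 0 then 1 / 2 else cnj w ^ k)" if "k < N" for k
    using that by (auto simp: complexify_def u_def complex_eq_iff)
  note ww = cnj_mult_self_eq_1[OF assms(2)]
  have shift: "w ^ m * cnj w ^ n = cnj w ^ (n - m)" "w ^ n * cnj w ^ m = w ^ (n - m)" if "m \<le> n" for m n
  proof -
    have "w ^ m * cnj w ^ m = 1" using ww by (metis mult.commute power_mult_distrib power_one)
    moreover have "cnj w ^ n = cnj w ^ m * cnj w ^ (n - m)" "w ^ n = w ^ m * w ^ (n - m)"
      using that by (simp_all flip: power_add)
    ultimately show "w ^ m * cnj w ^ n = cnj w ^ (n - m)" "w ^ n * cnj w ^ m = w ^ (n - m)"
      by (simp_all add: algebra_simps)
  qed
  have T_eq: "T N u $$ (m, n) = w ^ m * cnj w ^ n" if "m < N" "n < N" for m n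
  proof -
    have "complex_of_real (2 * u $ 0) = 1" using assms(1) by (simp add: u_def)
    then show ?thesis using that shift[of m n] shift[of n m] by (auto simp: T_index cu simp del: of_real_mult)
  qed
  have "psd_mat (T N u)"
    unfolding psd_mat_def
  proof (intro conjI ballI)
    show "square_mat (T N u)" by (simp add: dim_T)
    show "hermitian_mat (T N u)" by (rule hermitian_T)
    fix v :: "complex vec" assume "v \<in> carrier_vec (dim_row (T N u))"
    then have v: "v \<in> carrier_vec N" by (simp add: dim_T)
    let ?S = "\<Sum>n<N. cnj w ^ n * v $ n"
    have "(T N u *\<^sub>v v) \<bullet>c v = (\<Sum>m<N. \<Sum>n<N. cnj (cnj w ^ m * v $ m) * (cnj w ^ n * v $ n))"
      unfolding T_quadratic_form_eq_sum[OF v]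
      by (intro sum.cong) (auto simp: T_eq)
    also have "\<dots> = cnj ?S * ?S" by (simp add: sum_product)
    also have "\<dots> = of_real ((cmod ?S)\<^sup>2)" by (simp only: complex_norm_square mult.commute)
    finally show "0 \<le> Re ((T N u *\<^sub>v v) \<bullet>c v)" by simp
  qed
  then have "u \<in> toeplitz_cone N" by (simp add: toeplitz_cone_def u_def)
  then show thesis using that cu by blast
qed

lemma dual_cone_subset_finite_autocorrelations:
  assumes "N \<ge> 1"
  shows "dual_cone (2 * N - 1) (toeplitz_cone N) \<subseteq> finite_autocorrelations N"
proof
  fix z assume "z \<in> dual_cone (2 * N - 1) (toeplitz_cone N)"
  then have z: "z \<in> carrier_vec (2 * N - 1)" and zu: "\<And>u. u \<in> toeplitz_cone N \<Longrightarrow> 0 \<le> z \<bullet> u"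
    by (auto simp: dual_cone_def)
  obtain M where N: "N = Suc M" using assms by (cases N) auto
  let ?c = "\<lambda>k. complexify N z $ k"
  \<comment> \<open>The constant term is halved because \<open>B\<close> plus its conjugate counts
    it twice; this also matches the \<open>1 / 2\<close> in the exponential vectors.\<close>
  define B where "B = (\<Sum>k<N. monom (if k = 0 then ?c k / 2 else ?c k) k)"
  have coeff_B: "coeff B k = (if k < N then if k = 0 then ?c k / 2 else ?c k else 0)" for k
    by (simp add: B_def coeff_sum)
  \<comment> \<open>The shift puts \<open>B\<close> at indices \<open>M\<close> to
    \<open>2 * M\<close>, so that its reflection fills 0 to \<open>M\<close> and the two overlap
    only at \<open>M\<close>.\<close>
  define P where "P = monom 1 M * B"
  have "degree B \<le> M" by (rule degree_le) (simp add: coeff_B N)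
  then have degP: "degree P \<le> 2 * M"
    unfolding P_def using degree_mult_le[of "monom 1 M" B] degree_monom_le[of "1::complex" M] by simp
  \<comment> \<open>on the circle \<open>cnj x ^ M * p x = 2 * Re (B x)\<close>\<close>
  define p where "p = P + conj_reflect (2 * M) P"
  have degp: "degree p \<le> 2 * M"
    unfolding p_def by (intro degree_add_le degP degree_le) (simp add: coeff_conj_reflect)
  have "nonneg_on_circle M p"
    unfolding nonneg_on_circle_def
  proof (intro allI impI)
    fix w assume w: "cmod w = 1"
    note ww = cnj_mult_self_eq_1[OF w]
    obtain u where u: "u \<in> toeplitz_cone N"
      "\<And>k. k < N \<Longrightarrow> complexify N u $ k = (if k = 0 then 1 / 2 else cnj w ^ k)"
      using exponential_in_toeplitz_cone[OF assms w] by blast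
    have "z \<bullet> u = Re (\<Sum>k<N. ?c k * cnj (complexify N u $ k))"
      using u(1) by (intro scalar_prod_complexify[OF assms z]) (simp add: toeplitz_cone_def)
    also have "\<dots> = Re (poly B w)"
      unfolding B_def poly_sum poly_monom
      by (rule arg_cong[where f = Re], rule sum.cong) (auto simp: u(2))
    finally have B: "0 \<le> Re (poly B w)" using zu[OF u(1)] by simp
    have pow: "cnj w ^ M * w ^ M = 1" using ww by (metis power_mult_distrib power_one)
    have "w ^ (2 * M) = w ^ M * w ^ M" by (simp add: power_add mult_2)
    then have "cnj w ^ M * poly p w = (cnj w ^ M * w ^ M) * poly B w
        + (cnj w ^ M * w ^ M) * ((cnj w ^ M * w ^ M) * cnj (poly B w))"
      unfolding p_def poly_add poly_conj_reflect[OF degP ww]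
      by (simp add: P_def poly_monom distrib_left mult_ac)
    also have "\<dots> = of_real (2 * Re (poly B w))" unfolding pow by (simp add: complex_eq_iff)
    finally show "Im (cnj w ^ M * poly p w) = 0 \<and> 0 \<le> Re (cnj w ^ M * poly p w)" using B by simp
  qed
  then obtain q where q: "degree q \<le> M" "p = q * conj_reflect M q"
    using fejer_riesz_poly degp by blast
  let ?q = "vec N (coeff q)"
  have "?c k = (\<Sum>n = 0..N - 1 - k. cnj (?q $ n) * ?q $ (n + k))" if "k \<in> {0..N - 1}" for k
  proof -
    have k: "k \<le> M" using that N by simp
    \<comment> \<open>At the overlap \<open>k = 0\<close> the halves \<open>?c 0 / 2\<close> and its
      conjugate add up to \<open>?c 0\<close> because that entry is real.\<close>
    have "cnj (?c 0) = ?c 0" using assms by (simp add: complexify_def)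
    then have "?c k = coeff p (M + k)"
      using k by (auto simp: p_def P_def coeff_conj_reflect coeff_monom_mult coeff_B N mult_2)
    also have "\<dots> = (\<Sum>n<Suc M - k. cnj (coeff q n) * coeff q (n + k))"
      unfolding q(2) by (rule coeff_mult_conj_reflect[OF q(1)])
    also have "\<dots> = (\<Sum>n = 0..N - 1 - k. cnj (?q $ n) * ?q $ (n + k))"
      using k by (intro sum.cong) (auto simp: N)
    finally show ?thesis .
  qed
  then show "z \<in> finite_autocorrelations N"
    unfolding finite_autocorrelations_def using z by (auto intro!: bexI[of _ ?q])
qed

theorem mainTheorem2:
  fixes N :: nat
  assumes "N \<ge> 1"
  shows "dual_cone (2 * N - 1) (toeplitz_cone N) = finite_autocorrelations N"
  using dual_cone_subset_finite_autocorrelations[OF assms]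
    finite_autocorrelations_subset_dual_cone[OF assms] by (rule equalityI)

end
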